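(* Let $s<n$ be integers, $X=\{x\in\mathbb{R}^n: g(x)\le0,\ h(x)=0\}$ with $g_i$, $i=1,\dots,m$, convex and continuously differentiable and $h_i$, $i=1,\dots,p$, affine, and $f:\mathbb{R}^n\to\mathbb{R}$ continuously differentiable with Lipschitz continuous gradient on $\mathbb{R}^n$. Assume the KKT property stated in the context. Let $\{(x^k,y^k)\}$ be the sequence generated by Algorithm SNS equipped with $\mathcal{N}_\rho$ as neighborhood, started from $y^0\in\mathcal{Y}$, $x^0\in\mathcal{X}(y^0)$ with parameter $\xi>0$, and suppose that the level set $\{(x,y): y\in\mathcal{Y},\ x\in\mathcal{X}(y),\ f(x)\le f(x^0)+\xi\}$ is compact. Let $K_u=\{k\ge1:\eta_k<\eta_{k-1}\}$, let $\mathcal{A}^*$ be the set of accumulation points of $\{(x^k,y^k)\}_{k\in K_u}$, and let $\delta^*=\min\{\|x^*\|_0 : (x^*,y^* )\in\mathcal{A}^*\}$. If $\rho\ge2(s-\delta^* )$, then for every $(x^*,y^* )\in\mathcal{A}^*$ and every super support set $J\subset\{1,\dots,n\}$ of $x^*$ there exist multipliers $\lambda\in\mathbb{R}^m$, $\mu\in\mathbb{R}^p$, $\gamma\in\mathbb{R}^n$ such that $$\nabla f(x^* )+\sum_{i=1}^m\lambda_i\nabla g_i(x^* )+\sum_{i=1}^p\mu_i\nabla h_i(x^* )+\sum_{i=1}^n\gamma_ie_i=0,$$ $\lambda_i\ge0$ and $\lambda_ig_i(x^* )=0$ for all $i=1,\dots,m$, and $\gamma_i=0$ for all $i\in J$.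
   Context: $\|x\|_0$ is the number of nonzero components of $x$, $e$ is the all-ones vector, $e_i$ is the $i$-th standard unit vector, $\Pi_C$ is the Euclidean projection onto a nonempty closed convex set $C$. Put $\mathcal{Y}=\{y\in\{0,1\}^n : e^\top y\ge n-s\}$ and $\mathcal{X}(y)=\{x\in X : x_iy_i=0\ \forall i\}$ for $y\in\mathcal{Y}$ (closed and convex). A pair $(x,y)$ is feasible if $y\in\mathcal{Y}$ and $x\in\mathcal{X}(y)$. A sequence $(x^k,y^k)$ converges to $(\bar x,\bar y)$ if $x^k\to\bar x$ and $y^k=\bar y$ for all sufficiently large $k$; accumulation points are limits of convergent subsequences. A super support of $x^*$ (where $x^*\in X$, $\|x^*\|_0\le s$) is a set $J\subset\{1,\dots,n\}$ with $|J|=s$ and $\{i:x^*_i\neq0\}\subseteq J$. Stationarity: $\bar x\in\mathcal{X}(\bar y)$ is a stationary point of $\min\{f(x):x\in\mathcal{X}(\bar y)\}$ if $\bar x=\Pi_{\mathcal{X}(\bar y)}[\bar x-\nabla f(\bar x)]$. KKT property: for every $\bar y\in\mathcal{Y}$ and $\bar x\in\mathcal{X}(\bar y)$, $\bar x$ is a stationary point of $\min\{f(x):x\in\mathcal{X}(\bar y)\}$ if and only if there exist $\lambda\in\mathbb{R}^m$, $\mu\in\mathbb{R}^p$, $\gamma\in\mathbb{R}^n$ with $\nabla f(\bar x)+\sum_{i=1}^m\lambda_i\nabla g_i(\bar x)+\sum_{i=1}^p\mu_i\nabla h_i(\bar x)+\sum_{i=1}^n\gamma_ie_i=0$, $\lambda_i\ge0$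 and $\lambda_ig_i(\bar x)=0$ for all $i=1,\dots,m$, and $\gamma_i=0$ for all $i$ with $\bar y_i=0$. Neighborhood $\mathcal{N}_\rho$ ($\rho\in\mathbb{N}$): let $d_H$ be the Hamming distance on $\{0,1\}^n$, $J(y,\hat y)=\{i: y_i\ne\hat y_i\}$, and let $H_{J(y,\hat y)}(x)$ be obtained from $x$ by setting to $0$ all components with index in $J(y,\hat y)$. For a feasible pair $(x,y)$, $\mathcal{N}_\rho(x,y)$ is the set of pairs $(\hat x,\hat y)$ with $\hat y\in\mathcal{Y}$, $\mathcal{X}(\hat y)\ne\emptyset$, $d_H(\hat y,y)\le\rho$ and $\hat x=\Pi_{\mathcal{X}(\hat y)}\big(H_{J(y,\hat y)}(x)\big)$ (when $X=\mathbb{R}^n$ the projection leaves the point unchanged). Procedure PGLS$(x,y)$ (fixed constants $\gamma\in(0,\tfrac12)$, $\delta\in(0,1)$): for a feasible pair $(x,y)$ set $d=\Pi_{\mathcal{X}(y)}[x-\nabla f(x)]-x$; let $\alpha$ be the first element of $1,\delta,\delta^2,\dots$ with $f(x+\alpha d)\le f(x)+\gamma\alpha\nabla f(x)^\top d$; return $\tilde x=x+\alpha d$. (This scalar $\gamma$ is unrelated to the multiplier vector $\gamma$.) Algorithm SNS (with neighborhood $\mathcal{N}$; here $\mathcal{N}=\mathcal{N}_\rho$). Inputs: $y^0\in\mathcal{Y}$, $x^0\in\mathcal{X}(y^0)$, $\xi>0$, $\theta\in(0,1)$, $\eta_0>0$, $\mu_0>0$, $\delta'\in(0,1)$. For $k=0,1,2,\dots$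 (no stopping rule): Step 1: compute $\tilde x^k$ by PGLS$(x^k,y^k)$. Step 2: let $W_k=\{(x,y)\in\mathcal{N}(\tilde x^k,y^k): f(x)\le f(\tilde x^k)+\xi\}$. 2.1: if $W_k\ne\emptyset$, choose any $(x',y')\in W_k$, set $j=1$, $x^j=x'$ (inner iterates); otherwise go to Step 3. 2.2: compute $x^{j+1}$ by PGLS$(x^j,y')$. 2.3: if $f(x^{j+1})\le f(\tilde x^k)-\eta_k$, set $x^{k+1}=x^{j+1}$, $y^{k+1}=y'$, $\eta_{k+1}=\eta_k$ and go to Step 4. 2.4: if $\|x^j-\Pi_{\mathcal{X}(y')}[x^j-\nabla f(x^j)]\|>\|x^k-\Pi_{\mathcal{X}(y^k)}[x^k-\nabla f(x^k)]\|+\mu_k$, set $j=j+1$ and go to 2.2; otherwise remove $(x',y')$ from $W_k$ and go to 2.1. Step 3: set $x^{k+1}=\tilde x^k$, $y^{k+1}=y^k$; if $f(x^{k+1})\le f(x^k)-\eta_k$ set $\eta_{k+1}=\eta_k$, otherwise $\eta_{k+1}=\theta\eta_k$. Step 4: set $\mu_{k+1}=\delta'\mu_k$ and pass to iteration $k+1$. *)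

theory Defs
  imports "HOL-Analysis.Analysis"
begin

definition gradient :: "(real ^ 'n \<Rightarrow> real) \<Rightarrow> real ^ 'n \<Rightarrow> real ^ 'n" where
  "gradient f x = (THE D. GDERIV f x :> D)"

definition continuously_differentiable :: "(real ^ 'n \<Rightarrow> real) \<Rightarrow> bool" where
  "continuously_differentiable f \<longleftrightarrow>
     (\<forall>x. f differentiable (at x)) \<and> continuous_on UNIV (gradient f)"

definition affine_function :: "(real ^ 'n \<Rightarrow> real) \<Rightarrow> bool" where
  "affine_function f \<longleftrightarrow> (\<exists>a b. \<forall>x. f x = a \<bullet> x + b)"

definition norm0 :: "real ^ 'n \<Rightarrow> nat" where
  "norm0 x = card {i. x $ i \<noteq> 0}"

text \<open>Constraint families are indexed by \<open>{1..m}\<close> and \<open>{1..p}\<close>; \<open>m\<close> and \<open>p\<close> may be \<open>0\<close>.\<close>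

definition constraint_set ::
    "nat \<Rightarrow> nat \<Rightarrow> (nat \<Rightarrow> real ^ 'n \<Rightarrow> real) \<Rightarrow> (nat \<Rightarrow> real ^ 'n \<Rightarrow> real) \<Rightarrow> (real ^ 'n) set" where
  "constraint_set m p g h = {x. (\<forall>i\<in>{1..m}. g i x \<le> 0) \<and> (\<forall>i\<in>{1..p}. h i x = 0)}"

text \<open>Binary vectors are kept as elements of \<open>real ^ 'n\<close> with entries in \<open>{0, 1}\<close>.\<close>

definition Yset :: "nat \<Rightarrow> (real ^ 'n) set" where
  "Yset s = {y. (\<forall>i. y $ i \<in> {0, 1}) \<and> (\<Sum>i\<in>UNIV. y $ i) \<ge> real CARD('n) - real s}"

definition Xset :: "(real ^ 'n) set \<Rightarrow> real ^ 'n \<Rightarrow> (real ^ 'n) set" where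
  "Xset X y = {x \<in> X. \<forall>i. x $ i * y $ i = 0}"

definition super_support :: "nat \<Rightarrow> real ^ 'n \<Rightarrow> 'n set \<Rightarrow> bool" where
  "super_support s x J \<longleftrightarrow> card J = s \<and> {i. x $ i \<noteq> 0} \<subseteq> J"

definition stationary ::
    "(real ^ 'n) set \<Rightarrow> (real ^ 'n \<Rightarrow> real) \<Rightarrow> real ^ 'n \<Rightarrow> real ^ 'n \<Rightarrow> bool" where
  "stationary X f x y \<longleftrightarrow> x = closest_point (Xset X y) (x - gradient f x)"

text \<open>\<open>I\<close> is the set of indices on which the multiplier \<open>\<gamma>\<close> is required to vanish.\<close>

definition kkt_multipliers ::
    "nat \<Rightarrow> nat \<Rightarrow> (real ^ 'n \<Rightarrow> real) \<Rightarrow> (nat \<Rightarrow> real ^ 'n \<Rightarrow> real) \<Rightarrow> (nat \<Rightarrow> real ^ 'n \<Rightarrow> real) \<Rightarrow>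
     'n set \<Rightarrow> real ^ 'n \<Rightarrow> (nat \<Rightarrow> real) \<Rightarrow> (nat \<Rightarrow> real) \<Rightarrow> real ^ 'n \<Rightarrow> bool" where
  "kkt_multipliers m p f g h I x lam mu gam \<longleftrightarrow>
     gradient f x + (\<Sum>i=1..m. lam i *\<^sub>R gradient (g i) x)
       + (\<Sum>i=1..p. mu i *\<^sub>R gradient (h i) x) + (\<Sum>i\<in>UNIV. gam $ i *\<^sub>R axis i 1) = 0 \<and>
     (\<forall>i\<in>{1..m}. lam i \<ge> 0 \<and> lam i * g i x = 0) \<and>
     (\<forall>i\<in>I. gam $ i = 0)"

definition diff_set :: "real ^ 'n \<Rightarrow> real ^ 'n \<Rightarrow> 'n set" where
  "diff_set y y' = {i. y $ i \<noteq> y' $ i}"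

definition hamming :: "real ^ 'n \<Rightarrow> real ^ 'n \<Rightarrow> nat" where
  "hamming y y' = card (diff_set y y')"

definition zero_on :: "'n set \<Rightarrow> real ^ 'n \<Rightarrow> real ^ 'n" where
  "zero_on J x = (\<chi> i. if i \<in> J then 0 else x $ i)"

definition neighborhood ::
    "nat \<Rightarrow> nat \<Rightarrow> (real ^ 'n) set \<Rightarrow> real ^ 'n \<Rightarrow> real ^ 'n \<Rightarrow> ((real ^ 'n) \<times> (real ^ 'n)) set" where
  "neighborhood \<rho> s X x y =
     {(x', y'). y' \<in> Yset s \<and> Xset X y' \<noteq> {} \<and> hamming y' y \<le> \<rho> \<and>
        x' = closest_point (Xset X y') (zero_on (diff_set y y') x)}"

definition pg_residual ::
    "(real ^ 'n) set \<Rightarrow> (real ^ 'n \<Rightarrow> real) \<Rightarrow> real ^ 'n \<Rightarrow> real ^ 'n \<Rightarrow> real" where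
  "pg_residual X f x y = norm (x - closest_point (Xset X y) (x - gradient f x))"

text \<open>The step length is the first element of \<open>1, \<delta>, \<delta>\<^sup>2, \<dots>\<close> satisfying the sufficient decrease
  condition. Such an element exists for differentiable \<open>f\<close>, feasible \<open>(x, y)\<close>, closed convex \<open>X\<close>,
  \<open>0 < \<gamma> < 1/2\<close> and \<open>0 < \<delta> < 1\<close>.\<close>

definition PGLS ::
    "real \<Rightarrow> real \<Rightarrow> (real ^ 'n) set \<Rightarrow> (real ^ 'n \<Rightarrow> real) \<Rightarrow> real ^ 'n \<Rightarrow> real ^ 'n \<Rightarrow> real ^ 'n" where
  "PGLS \<gamma> \<delta> X f x y =
     (let d = closest_point (Xset X y) (x - gradient f x) - x;
          l = (LEAST l. f (x + \<delta> ^ l *\<^sub>R d) \<le> f x + \<gamma> * \<delta> ^ l * (gradient f x \<bullet> d))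
      in x + \<delta> ^ l *\<^sub>R d)"

text \<open>Terminating runs of the inner loop (Steps 2.2--2.4) for a fixed \<open>y'\<close>, started at the
  inner iterate \<open>x\<^sup>j\<close>. Here \<open>target\<close> stands for \<open>f(PGLS(x\<^sup>k, y\<^sup>k)) - \<eta>\<^sub>k\<close> and \<open>thr\<close> for the residual of
  \<open>(x\<^sup>k, y\<^sup>k)\<close> plus \<open>\<mu>\<^sub>k\<close>. The result \<open>Some u\<close> means that \<open>u = x\<^sup>j\<^sup>+\<^sup>1\<close> was accepted in Step 2.3;
  \<open>None\<close> means that the candidate is to be removed from \<open>W\<^sub>k\<close>.\<close>

inductive inner_loop ::
    "real \<Rightarrow> real \<Rightarrow> (real ^ 'n) set \<Rightarrow> (real ^ 'n \<Rightarrow> real) \<Rightarrow> real \<Rightarrow> real \<Rightarrow> real ^ 'n \<Rightarrow>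
     real ^ 'n \<Rightarrow> (real ^ 'n) option \<Rightarrow> bool"
  for \<gamma> \<delta> X f target thr y' where
  accept: "f (PGLS \<gamma> \<delta> X f xj y') \<le> target \<Longrightarrow>
     inner_loop \<gamma> \<delta> X f target thr y' xj (Some (PGLS \<gamma> \<delta> X f xj y'))"
| continue: "\<lbrakk>\<not> f (PGLS \<gamma> \<delta> X f xj y') \<le> target; pg_residual X f xj y' > thr;
      inner_loop \<gamma> \<delta> X f target thr y' (PGLS \<gamma> \<delta> X f xj y') r\<rbrakk> \<Longrightarrow>
     inner_loop \<gamma> \<delta> X f target thr y' xj r"
| reject: "\<lbrakk>\<not> f (PGLS \<gamma> \<delta> X f xj y') \<le> target; \<not> pg_residual X f xj y' > thr\<rbrakk> \<Longrightarrow>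
     inner_loop \<gamma> \<delta> X f target thr y' xj None"

text \<open>Terminating runs of the loop 2.1--2.4 with the current set \<open>W\<close> of candidates, which are
  picked in an arbitrary order. \<open>Some (u, v)\<close> is a success leading to \<open>(x\<^sup>k\<^sup>+\<^sup>1, y\<^sup>k\<^sup>+\<^sup>1) = (u, v)\<close>;
  \<open>None\<close> means that \<open>W\<close> has been exhausted.\<close>

inductive search_loop ::
    "real \<Rightarrow> real \<Rightarrow> (real ^ 'n) set \<Rightarrow> (real ^ 'n \<Rightarrow> real) \<Rightarrow> real \<Rightarrow> real \<Rightarrow>
     ((real ^ 'n) \<times> (real ^ 'n)) set \<Rightarrow> ((real ^ 'n) \<times> (real ^ 'n)) option \<Rightarrow> bool"
  for \<gamma> \<delta> X f target thr where
  exhausted: "search_loop \<gamma> \<delta> X f target thr {} None"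
| success: "\<lbrakk>(x', y') \<in> W; inner_loop \<gamma> \<delta> X f target thr y' x' (Some u)\<rbrakk> \<Longrightarrow>
     search_loop \<gamma> \<delta> X f target thr W (Some (u, y'))"
| remove: "\<lbrakk>(x', y') \<in> W; inner_loop \<gamma> \<delta> X f target thr y' x' None;
      search_loop \<gamma> \<delta> X f target thr (W - {(x', y')}) r\<rbrakk> \<Longrightarrow>
     search_loop \<gamma> \<delta> X f target thr W r"

text \<open>One iteration of the algorithm, from \<open>(x\<^sup>k, y\<^sup>k, \<eta>\<^sub>k, \<mu>\<^sub>k)\<close> to
  \<open>(x\<^sup>k\<^sup>+\<^sup>1, y\<^sup>k\<^sup>+\<^sup>1, \<eta>\<^sub>k\<^sub>+\<^sub>1, \<mu>\<^sub>k\<^sub>+\<^sub>1)\<close>; a relation because of the free choices in Step 2.1.\<close>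

definition SNS_step ::
    "real \<Rightarrow> real \<Rightarrow> real \<Rightarrow> real \<Rightarrow> real \<Rightarrow>
     (real ^ 'n \<Rightarrow> real ^ 'n \<Rightarrow> ((real ^ 'n) \<times> (real ^ 'n)) set) \<Rightarrow>
     (real ^ 'n) set \<Rightarrow> (real ^ 'n \<Rightarrow> real) \<Rightarrow>
     (real ^ 'n) \<times> (real ^ 'n) \<times> real \<times> real \<Rightarrow> (real ^ 'n) \<times> (real ^ 'n) \<times> real \<times> real \<Rightarrow> bool" where
  "SNS_step \<gamma> \<delta> \<xi> \<theta> \<delta>' N X f = (\<lambda>(x, y, \<eta>, \<mu>) (x1, y1, \<eta>1, \<mu>1).
     let xt = PGLS \<gamma> \<delta> X f x y;
         W = {(u, v) \<in> N xt y. f u \<le> f xt + \<xi>}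
     in (\<exists>r. search_loop \<gamma> \<delta> X f (f xt - \<eta>) (pg_residual X f x y + \<mu>) W r \<and>
           (case r of
              Some (u, v) \<Rightarrow> x1 = u \<and> y1 = v \<and> \<eta>1 = \<eta>
            | None \<Rightarrow> x1 = xt \<and> y1 = y \<and> \<eta>1 = (if f x1 \<le> f x - \<eta> then \<eta> else \<theta> * \<eta>))) \<and>
        \<mu>1 = \<delta>' * \<mu>)"

definition SNS_sequence ::
    "real \<Rightarrow> real \<Rightarrow> real \<Rightarrow> real \<Rightarrow> real \<Rightarrow>
     (real ^ 'n \<Rightarrow> real ^ 'n \<Rightarrow> ((real ^ 'n) \<times> (real ^ 'n)) set) \<Rightarrow>
     (real ^ 'n) set \<Rightarrow> (real ^ 'n \<Rightarrow> real) \<Rightarrow>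
     (nat \<Rightarrow> real ^ 'n) \<Rightarrow> (nat \<Rightarrow> real ^ 'n) \<Rightarrow> (nat \<Rightarrow> real) \<Rightarrow> (nat \<Rightarrow> real) \<Rightarrow> bool" where
  "SNS_sequence \<gamma> \<delta> \<xi> \<theta> \<delta>' N X f x y \<eta> \<mu> \<longleftrightarrow>
     (\<forall>k. SNS_step \<gamma> \<delta> \<xi> \<theta> \<delta>' N X f
            (x k, y k, \<eta> k, \<mu> k) (x (Suc k), y (Suc k), \<eta> (Suc k), \<mu> (Suc k)))"

definition accumulation_points ::
    "nat set \<Rightarrow> (nat \<Rightarrow> real ^ 'n) \<Rightarrow> (nat \<Rightarrow> real ^ 'n) \<Rightarrow> ((real ^ 'n) \<times> (real ^ 'n)) set" where
  "accumulation_points K x y =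
     {(xb, yb). \<exists>r. strict_mono r \<and> range r \<subseteq> K \<and>
        (\<lambda>j. x (r j)) \<longlonglongrightarrow> xb \<and> (\<forall>\<^sub>F j in sequentially. y (r j) = yb)}"

end

(* The line search has a step length bounded below uniformly in the point, so it decreases f by at
   least a fixed multiple of the squared projected gradient residual. Write (xbar, ybar) for an
   accumulation point and let k range over the indices in K_u defining it. The step leading to x^k
   has rejected every candidate, and eta_{k-1} tends to 0. The lower bound on rho makes the
   complement y' of a super support of xbar admissible as a neighbour of ybar, and its starting
   point u^k, the projection onto X(y') of x^k with some components zeroed, tends to xbar.
   Rejection means that already the first line search step from u^k decreases f by less than
   f(u^k) - f(x^k) + eta_{k-1}, which tends to 0. So the residual at u^k tends to 0, xbar is
   stationary over X(y'), and the KKT property yields the multipliers. *)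
theory Submission
  imports Defs
begin

section \<open>Gradients and the projected gradient line search\<close>

text \<open>\<open>gradient\<close> is a definite description, so existence and uniqueness are both
  required. The derivative is a linear functional, represented by the vector
  \<open>adjoint f' 1\<close>.\<close>

lemma gderiv_gradient:
  fixes f :: "real ^ 'n \<Rightarrow> real"
  assumes "f differentiable (at x)"
  shows "GDERIV f x :> gradient f x"
proof -
  obtain f' where f': "(f has_derivative f') (at x)"
    using assms by (auto simp: differentiable_def)
  interpret bounded_linear f' by (rule has_derivative_bounded_linear[OF f'])
  have "f' = (\<lambda>h. h \<bullet> adjoint f' 1)"
    using adjoint_works[OF linear_axioms, of _ 1] by (simp add: fun_eq_iff)
  then have D: "GDERIV f x :> adjoint f' 1"
    using f' unfolding gderiv_def by simp
  have "D = adjoint f' 1" if "GDERIV f x :> D" for D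
  proof -
    have "(\<lambda>h. h \<bullet> D) = (\<lambda>h. h \<bullet> adjoint f' 1)"
      using has_derivative_unique that D unfolding gderiv_def by blast
    then show ?thesis
      by (metis vector_eq_ldot)
  qed
  with D show ?thesis
    unfolding gradient_def by (metis theI)
qed

lemma continuously_differentiable_imp_continuous_on:
  "continuously_differentiable f \<Longrightarrow> continuous_on A f"
  unfolding continuously_differentiable_def
  by (meson continuous_at_imp_continuous_on differentiable_imp_continuous_within)

text \<open>By the mean value theorem the increment uses the gradient at an intermediate point,
  which differs from the one at \<open>x\<close> by at most \<open>L * a * norm d\<close>. The
  constant \<open>L\<close> instead of \<open>L / 2\<close> is enough, since only some positive
  lower bound on the step length matters.\<close>

lemma lipschitz_gradient_bound:
  fixes f :: "real ^ 'n \<Rightarrow> real"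
  assumes f: "continuously_differentiable f"
    and L: "L-lipschitz_on UNIV (gradient f)"
    and "a > 0"
  shows "f (x + a *\<^sub>R d) \<le> f x + a * (gradient f x \<bullet> d) + L * a\<^sup>2 * (norm d)\<^sup>2"
proof -
  have "((\<lambda>t. f (x + t *\<^sub>R d)) has_derivative (\<lambda>t. t * (gradient f (x + z *\<^sub>R d) \<bullet> d))) (at z)" for z
  proof -
    have "(f has_derivative (\<lambda>h. h \<bullet> gradient f (x + z *\<^sub>R d))) (at (x + z *\<^sub>R d))"
      using gderiv_gradient f unfolding continuously_differentiable_def gderiv_def by blast
    moreover have "((\<lambda>t. x + t *\<^sub>R d) has_derivative (\<lambda>t. t *\<^sub>R d)) (at z)"
      by (auto intro!: derivative_eq_intros)
    ultimately show ?thesis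
      using has_derivative_compose by (fastforce simp: inner_commute)
  qed
  then obtain z where z: "0 < z" "z < a"
    and eq: "f (x + a *\<^sub>R d) - f (x + 0 *\<^sub>R d) = (a - 0) * (gradient f (x + z *\<^sub>R d) \<bullet> d)"
    using mvt_simple[OF \<open>a > 0\<close>, of "\<lambda>t. f (x + t *\<^sub>R d)"
        "\<lambda>z t. t * (gradient f (x + z *\<^sub>R d) \<bullet> d)"]
    by (force intro: has_derivative_at_withinI)
  have "L \<ge> 0"
    using L by (rule lipschitz_on_nonneg)
  have "norm (gradient f (x + z *\<^sub>R d) - gradient f x) \<le> L * (z * norm d)"
    using lipschitz_onD[OF L, of "x + z *\<^sub>R d" x] z by (simp add: dist_norm)
  also have "\<dots> \<le> L * (a * norm d)"
    using z \<open>L \<ge> 0\<close> by (intro mult_left_mono mult_right_mono) auto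
  finally have "(gradient f (x + z *\<^sub>R d) - gradient f x) \<bullet> d \<le> L * (a * norm d) * norm d"
    by (meson mult_right_mono norm_cauchy_schwarz norm_ge_zero order_trans)
  then have "gradient f (x + z *\<^sub>R d) \<bullet> d \<le> gradient f x \<bullet> d + L * a * (norm d)\<^sup>2"
    by (simp add: inner_diff_left power2_eq_square algebra_simps)
  then have "a * (gradient f (x + z *\<^sub>R d) \<bullet> d) \<le> a * (gradient f x \<bullet> d + L * a * (norm d)\<^sup>2)"
    using \<open>a > 0\<close> by simp
  then show ?thesis
    using eq by (simp add: power2_eq_square algebra_simps)
qed

text \<open>The variational inequality of the projection of \<open>x - v\<close>, tested at the
  point \<open>x\<close> of \<open>C\<close>.\<close>

lemma projected_gradient_descent_direction:
  fixes x v :: "'a::euclidean_space"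
  assumes "convex C" "closed C" "x \<in> C"
  defines "d \<equiv> closest_point C (x - v) - x"
  shows "v \<bullet> d \<le> - (norm d)\<^sup>2"
  using closest_point_dot[OF assms(1-3), of "x - v"]
  unfolding d_def power2_norm_eq_inner by (simp add: algebra_simps inner_commute)

text \<open>The constant is \<open>\<gamma> * \<delta> ^ N\<close>, where \<open>N\<close> depends
  only on \<open>L\<close> and \<open>\<delta>\<close>. One \<open>c\<close> therefore serves all
  points and all sets \<open>Xset X y\<close>, which lets the bound pass to the limit along a
  sequence.\<close>

lemma PGLS_sufficient_decrease:
  fixes f :: "real ^ 'n \<Rightarrow> real"
  assumes f: "continuously_differentiable f"
    and L: "\<exists>L. L-lipschitz_on UNIV (gradient f)"
    and \<gamma>: "0 < \<gamma>" "\<gamma> < 1/2"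
    and \<delta>: "0 < \<delta>" "\<delta> < 1"
  obtains c where "c > 0"
    "\<And>X x y. closed (Xset X y) \<Longrightarrow> convex (Xset X y) \<Longrightarrow> x \<in> Xset X y \<Longrightarrow>
       c * (pg_residual X f x y)\<^sup>2 \<le> f x - f (PGLS \<gamma> \<delta> X f x y)"
proof -
  obtain L where L: "L-lipschitz_on UNIV (gradient f)"
    using L by blast
  have "L \<ge> 0"
    using L by (rule lipschitz_on_nonneg)
  have "(\<lambda>l. L * \<delta> ^ l) \<longlonglongrightarrow> L * 0"
    using \<delta> by (intro tendsto_intros LIMSEQ_power_zero) auto
  then have "\<forall>\<^sub>F l in sequentially. L * \<delta> ^ l < 1/2"
    by (rule order_tendstoD) simp
  then obtain N where N: "L * \<delta> ^ N < 1/2"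
    by (auto simp: eventually_sequentially)
  have dec: "\<gamma> * \<delta> ^ N * (pg_residual X f x y)\<^sup>2 \<le> f x - f (PGLS \<gamma> \<delta> X f x y)"
    if C: "closed (Xset X y)" "convex (Xset X y)" "x \<in> Xset X y" for X x y
  proof -
    define d where "d = closest_point (Xset X y) (x - gradient f x) - x"
    define P where "P l \<longleftrightarrow>
      f (x + \<delta> ^ l *\<^sub>R d) \<le> f x + \<gamma> * \<delta> ^ l * (gradient f x \<bullet> d)" for l
    have gd: "gradient f x \<bullet> d \<le> - (norm d)\<^sup>2"
      unfolding d_def by (rule projected_gradient_descent_direction[OF C(2,1,3)])
    have "P N"
    proof -
      have "L * \<delta> ^ N * (norm d)\<^sup>2 \<le> (1 - \<gamma>) * (norm d)\<^sup>2"
        using N \<gamma> by (intro mult_right_mono) auto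
      also have "\<dots> \<le> (1 - \<gamma>) * - (gradient f x \<bullet> d)"
        using gd \<gamma> by (intro mult_left_mono) auto
      finally have "\<delta> ^ N * (L * \<delta> ^ N * (norm d)\<^sup>2) \<le> \<delta> ^ N * ((1 - \<gamma>) * - (gradient f x \<bullet> d))"
        using \<delta> by (intro mult_left_mono) auto
      then show ?thesis
        using lipschitz_gradient_bound[OF f L, of "\<delta> ^ N" x d] \<delta>
        unfolding P_def by (simp add: power2_eq_square algebra_simps)
    qed
    define l where "l = (LEAST l. P l)"
    \<comment> \<open>The line search stops no later than \<open>N\<close>, so the accepted step
      length is at least \<open>\<delta> ^ N\<close>.\<close>
    have "P l" "l \<le> N"
      using \<open>P N\<close> unfolding l_def by (auto intro: LeastI Least_le)
    have "\<delta> ^ N \<le> \<delta> ^ l"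
      using \<open>l \<le> N\<close> \<delta> by (intro power_decreasing) auto
    then have "\<gamma> * \<delta> ^ N * (norm d)\<^sup>2 \<le> \<gamma> * \<delta> ^ l * (norm d)\<^sup>2"
      using \<gamma> by (intro mult_right_mono mult_left_mono) auto
    also have "\<dots> \<le> \<gamma> * \<delta> ^ l * - (gradient f x \<bullet> d)"
      using gd \<gamma> \<delta> by (intro mult_left_mono) auto
    also have "\<dots> \<le> f x - f (x + \<delta> ^ l *\<^sub>R d)"
      using \<open>P l\<close> unfolding P_def by simp
    also have "x + \<delta> ^ l *\<^sub>R d = PGLS \<gamma> \<delta> X f x y"
      unfolding PGLS_def Let_def l_def P_def d_def ..
    finally show ?thesis
      unfolding pg_residual_def d_def by (simp add: norm_minus_commute)
  qed
  show thesis
    by (rule that[of "\<gamma> * \<delta> ^ N"]) (use \<gamma> \<delta> dec in auto)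
qed

text \<open>For every exponent the trial point is a convex combination of \<open>x\<close> and its
  projected gradient point.\<close>

lemma PGLS_in_Xset:
  fixes f :: "real ^ 'n \<Rightarrow> real"
  assumes C: "closed (Xset X y)" "convex (Xset X y)" "x \<in> Xset X y"
    and \<delta>: "0 < \<delta>" "\<delta> < 1"
  shows "PGLS \<gamma> \<delta> X f x y \<in> Xset X y"
proof -
  have conv: "x + \<delta> ^ l *\<^sub>R (q - x) \<in> Xset X y" if "q \<in> Xset X y" for l q
  proof -
    have "(1 - \<delta> ^ l) *\<^sub>R x + \<delta> ^ l *\<^sub>R q \<in> Xset X y"
      using C that \<delta> by (intro convexD) (auto intro: power_le_one)
    then show ?thesis
      by (simp add: algebra_simps)
  qed
  show ?thesis
    unfolding PGLS_def Let_def using C by (intro conv closest_point_in_set) auto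
qed

section \<open>Outcomes of the inner loop and of the candidate search\<close>

text \<open>Whether the run stops at once or continues, its first line search step has failed the
  target test; hence a case distinction on the last rule suffices.\<close>

lemma inner_loop_None:
  "inner_loop \<gamma> \<delta> X f target thr y' u None \<Longrightarrow> target < f (PGLS \<gamma> \<delta> X f u y')"
  by (erule inner_loop.cases) auto

text \<open>The search ends with \<open>None\<close> only on the empty set, so each candidate was
  removed at some point, after a failed inner loop.\<close>

lemma search_loop_None:
  fixes u v :: "real ^ 'n"
  assumes "search_loop \<gamma> \<delta> X f target thr W None" "(u, v) \<in> W"
  shows "target < f (PGLS \<gamma> \<delta> X f u v)"
  using assms
proof (induction W "None :: ((real ^ 'n) \<times> (real ^ 'n)) option" rule: search_loop.induct)
  case (remove x' y' W)
  then show ?case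
    using inner_loop_None by (cases "(u, v) = (x', y')") auto
qed auto

lemma search_loop_Some:
  assumes "search_loop \<gamma> \<delta> X f target thr W (Some (u, v))"
  shows "\<exists>w. (w, v) \<in> W \<and> inner_loop \<gamma> \<delta> X f target thr v w (Some u)"
  using assms
  by (induction W "Some (u, v)" rule: search_loop.induct) auto

lemma inner_loop_Some_in_Xset:
  assumes "inner_loop \<gamma> \<delta> X f target thr v w (Some u)" "w \<in> Xset X v"
    and "closed (Xset X v)" "convex (Xset X v)" "0 < \<delta>" "\<delta> < 1"
  shows "u \<in> Xset X v"
  using assms
  by (induction w "Some u" rule: inner_loop.induct) (auto intro: PGLS_in_Xset)

section \<open>Closedness and convexity of the feasible sets\<close>

lemma Xset_conv_Int: "Xset X y = X \<inter> (\<Inter>i\<in>{i. y $ i \<noteq> 0}. {x. x $ i = 0})"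
  unfolding Xset_def by auto

lemma closed_Xset:
  assumes "closed X"
  shows "closed (Xset X y)"
  unfolding Xset_conv_Int
  by (intro closed_Int assms closed_INT ballI closed_Collect_eq continuous_intros)

lemma convex_Xset:
  assumes "convex X"
  shows "convex (Xset X y)"
proof -
  have "convex {x :: real ^ 'n. x $ i = 0}" for i
    by (auto simp: convex_def)
  then show ?thesis
    unfolding Xset_conv_Int by (intro convex_Int assms convex_INT)
qed

lemma affine_function_imp_continuous_on:
  fixes h :: "real ^ 'n \<Rightarrow> real"
  assumes "affine_function h"
  shows "continuous_on A h"
proof -
  obtain a b where "h = (\<lambda>x. a \<bullet> x + b)"
    using assms unfolding affine_function_def by auto
  then show ?thesis
    by (auto intro!: continuous_intros)
qed

lemma closed_constraint_set:
  fixes g h :: "nat \<Rightarrow> real ^ 'n \<Rightarrow> real"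
  assumes "\<And>i. i \<in> {1..m} \<Longrightarrow> continuous_on UNIV (g i)"
    and "\<And>i. i \<in> {1..p} \<Longrightarrow> continuous_on UNIV (h i)"
  shows "closed (constraint_set m p g h)"
proof -
  have "constraint_set m p g h
    = (\<Inter>i\<in>{1..m}. {x. g i x \<le> 0}) \<inter> (\<Inter>i\<in>{1..p}. {x. h i x = 0})"
    unfolding constraint_set_def by auto
  then show ?thesis
    using assms
    by (auto intro!: closed_Int closed_INT closed_Collect_eq closed_Collect_le continuous_on_const)
qed

lemma convex_constraint_set:
  fixes g h :: "nat \<Rightarrow> real ^ 'n \<Rightarrow> real"
  assumes g: "\<And>i. i \<in> {1..m} \<Longrightarrow> convex_on UNIV (g i)"
    and h: "\<And>i. i \<in> {1..p} \<Longrightarrow> affine_function (h i)"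
  shows "convex (constraint_set m p g h)"
proof -
  have "convex {x. g i x \<le> 0}" if "i \<in> {1..m}" for i
  proof (rule convexI)
    fix x y :: "real ^ 'n" and u v :: real
    assume *: "x \<in> {x. g i x \<le> 0}" "y \<in> {x. g i x \<le> 0}" "0 \<le> u" "0 \<le> v" "u + v = 1"
    have "g i (u *\<^sub>R x + v *\<^sub>R y) \<le> u * g i x + v * g i y"
      using g[OF that] * unfolding convex_on_def by auto
    also have "\<dots> \<le> 0"
      using * by (simp add: add_nonpos_nonpos mult_nonneg_nonpos)
    finally show "u *\<^sub>R x + v *\<^sub>R y \<in> {x. g i x \<le> 0}" by simp
  qed
  moreover have "convex {x. h i x = 0}" if i: "i \<in> {1..p}" for i
  proof -
    obtain a b where "\<And>x. h i x = a \<bullet> x + b"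
      using h[OF i] unfolding affine_function_def by auto
    then have "{x. h i x = 0} = {x. a \<bullet> x = - b}"
      by auto
    then show ?thesis
      by (simp add: convex_hyperplane)
  qed
  moreover have "constraint_set m p g h
    = (\<Inter>i\<in>{1..m}. {x. g i x \<le> 0}) \<inter> (\<Inter>i\<in>{1..p}. {x. h i x = 0})"
    unfolding constraint_set_def by auto
  ultimately show ?thesis
    by (auto intro!: convex_Int convex_INT)
qed

section \<open>Binary vectors and Hamming distance\<close>

text \<open>The entries are 0 or 1, so their sum counts the nonzero ones.\<close>

lemma Yset_card_zeros:
  fixes v :: "real ^ 'n"
  assumes "v \<in> Yset s"
  shows "card {i. v $ i = 0} \<le> s"
proof -
  have "(\<Sum>i\<in>UNIV. v $ i) = (\<Sum>i\<in>UNIV. if i \<in> - {i. v $ i = 0} then 1 else 0)"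
    using assms unfolding Yset_def by (intro sum.cong) auto
  also have "\<dots> = card (- {i. v $ i = 0})"
    by (simp add: Compl_eq flip: sum.inter_filter)
  also have "real (card (- {i. v $ i = 0})) = real CARD('n) - card {i. v $ i = 0}"
    by (simp add: Compl_eq_Diff_UNIV card_Diff_subset of_nat_diff card_mono)
  finally show ?thesis
    using assms unfolding Yset_def by simp
qed

text \<open>Both binary vectors vanish on the support of \<open>u\<close>. Where they differ,
  exactly one vanishes, so the index lies off the support and in \<open>J\<close> or in the zero set
  of \<open>v\<close>. Each of these contributes at most \<open>s - norm0 u\<close> indices, whence
  the factor 2.\<close>

lemma hamming_indicator_le:
  fixes v :: "real ^ 'n"
  assumes v: "v \<in> Yset s" and u: "u \<in> Xset X v"
    and J: "super_support s u J"
  shows "hamming (\<chi> i. if i \<in> J then 0 else 1) v \<le> 2 * (s - norm0 u)"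
proof -
  let ?S = "{i. u $ i \<noteq> 0}" and ?I = "{i. v $ i = 0}"
  have "?S \<subseteq> J" "card J = s" "?S \<subseteq> ?I"
    using J u unfolding super_support_def Xset_def by auto
  have "diff_set (\<chi> i. if i \<in> J then 0 else 1) v \<subseteq> (J - ?S) \<union> (?I - ?S)"
    using v \<open>?S \<subseteq> J\<close> \<open>?S \<subseteq> ?I\<close> unfolding diff_set_def Yset_def by (auto split: if_splits)
  then have "hamming (\<chi> i. if i \<in> J then 0 else 1) v \<le> card ((J - ?S) \<union> (?I - ?S))"
    unfolding hamming_def by (simp add: card_mono)
  also have "\<dots> \<le> card (J - ?S) + card (?I - ?S)"
    by (rule card_Un_le)
  also have "\<dots> = (s - norm0 u) + (card ?I - norm0 u)"
    using \<open>?S \<subseteq> J\<close> \<open>?S \<subseteq> ?I\<close> \<open>card J = s\<close> unfolding norm0_def by (simp add: card_Diff_subset)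
  finally show ?thesis
    using Yset_card_zeros[OF v] by linarith
qed

lemma indicator_in_Yset:
  fixes J :: "'n::finite set"
  assumes "card J = s"
  shows "(\<chi> i. if i \<in> J then 0 else 1) \<in> Yset s"
proof -
  have "(\<Sum>i\<in>UNIV. if i \<in> J then 0 else 1 :: real) = (\<Sum>i\<in>UNIV. if i \<in> - J then 1 else 0)"
    by (intro sum.cong) auto
  also have "\<dots> = card (- J)"
    by (simp add: Compl_eq flip: sum.inter_filter)
  also have "real (card (- J)) = real CARD('n) - card J"
    by (simp add: Compl_eq_Diff_UNIV card_Diff_subset of_nat_diff card_mono)
  finally show ?thesis
    using assms unfolding Yset_def by simp
qed

section \<open>One iteration of the algorithm\<close>

lemma neighborhood_feasible:
  assumes "(u, v) \<in> neighborhood \<rho> s X x y" "closed (Xset X v)"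
  shows "v \<in> Yset s" "u \<in> Xset X v"
  using assms unfolding neighborhood_def by (auto intro: closest_point_in_set)

lemma SNS_step_feasible:
  assumes step: "SNS_step \<gamma> \<delta> \<xi> \<theta> \<delta>' (neighborhood \<rho> s X) X f (x, y, \<eta>, \<mu>) (x1, y1, \<eta>1, \<mu>1)"
    and X: "closed X" "convex X" and \<delta>: "0 < \<delta>" "\<delta> < 1"
    and xy: "y \<in> Yset s" "x \<in> Xset X y"
  shows "y1 \<in> Yset s \<and> x1 \<in> Xset X y1"
proof -
  define W where
    "W = {(u, v) \<in> neighborhood \<rho> s X (PGLS \<gamma> \<delta> X f x y) y. f u \<le> f (PGLS \<gamma> \<delta> X f x y) + \<xi>}"
  obtain r where r: "search_loop \<gamma> \<delta> X f (f (PGLS \<gamma> \<delta> X f x y) - \<eta>) (pg_residual X f x y + \<mu>) W r"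
    and res: "case r of Some (u, v) \<Rightarrow> x1 = u \<and> y1 = v | None \<Rightarrow> x1 = PGLS \<gamma> \<delta> X f x y \<and> y1 = y"
    using step unfolding SNS_step_def Let_def W_def by (force split: option.splits)
  show ?thesis
  proof (cases r)
    case None
    then show ?thesis
      using res xy X \<delta> by (auto intro: PGLS_in_Xset closed_Xset convex_Xset)
  next
    case (Some q)
    then have "search_loop \<gamma> \<delta> X f (f (PGLS \<gamma> \<delta> X f x y) - \<eta>) (pg_residual X f x y + \<mu>) W
        (Some (x1, y1))"
      using r res by (cases q) auto
    then obtain w where w: "(w, y1) \<in> W"
      "inner_loop \<gamma> \<delta> X f (f (PGLS \<gamma> \<delta> X f x y) - \<eta>) (pg_residual X f x y + \<mu>) y1 w (Some x1)"
      using search_loop_Some by blast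
    then have "y1 \<in> Yset s" "w \<in> Xset X y1"
      using neighborhood_feasible closed_Xset[OF X(1)] unfolding W_def by blast+
    then show ?thesis
      using w(2) X \<delta> by (blast intro: inner_loop_Some_in_Xset closed_Xset convex_Xset)
  qed
qed

lemma SNS_step_eta_cases:
  assumes "SNS_step \<gamma> \<delta> \<xi> \<theta> \<delta>' N X f (x, y, \<eta>, \<mu>) (x1, y1, \<eta>1, \<mu>1)"
  shows "\<eta>1 = \<eta> \<or> \<eta>1 = \<theta> * \<eta>"
  using assms unfolding SNS_step_def Let_def by (auto split: option.splits)

text \<open>An accepted candidate leaves \<open>\<eta>\<close> unchanged, so a decrease means that
  the search was exhausted. Then \<open>x1\<close> is the line search point itself, the centre of
  the neighborhood, and every candidate was rejected.\<close>

lemma SNS_step_eta_decreased: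
  assumes "SNS_step \<gamma> \<delta> \<xi> \<theta> \<delta>' N X f (x, y, \<eta>, \<mu>) (x1, y1, \<eta>1, \<mu>1)" "\<eta>1 < \<eta>"
  shows "y1 = y" "\<eta>1 = \<theta> * \<eta>"
    and "\<And>u v. (u, v) \<in> N x1 y \<Longrightarrow> f u \<le> f x1 + \<xi> \<Longrightarrow> f x1 - \<eta> < f (PGLS \<gamma> \<delta> X f u v)"
  using assms unfolding SNS_step_def Let_def
  by (auto simp del: not_None_eq split: option.splits if_splits dest: search_loop_None)

text \<open>Projection and gradient are continuous, hence so is the residual vector, which must
  vanish at the limit.\<close>

lemma stationary_limit:
  fixes f :: "real ^ 'n \<Rightarrow> real"
  assumes f: "continuously_differentiable f"
    and C: "closed (Xset X v)" "convex (Xset X v)" "Xset X v \<noteq> {}"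
    and u: "u \<longlonglongrightarrow> z" and res: "(\<lambda>j. pg_residual X f (u j) v) \<longlonglongrightarrow> 0"
  shows "stationary X f z v"
proof -
  let ?r = "\<lambda>x. x - closest_point (Xset X v) (x - gradient f x)"
  have "continuous_on UNIV (\<lambda>x. x - gradient f x)"
    using f unfolding continuously_differentiable_def by (auto intro!: continuous_intros)
  then have "continuous_on UNIV (\<lambda>x. closest_point (Xset X v) (x - gradient f x))"
    using continuous_on_compose2[OF continuous_on_closest_point[OF C(2,1,3), of UNIV]] by blast
  then have "continuous_on UNIV ?r"
    by (intro continuous_intros)
  then have "(\<lambda>j. ?r (u j)) \<longlonglongrightarrow> ?r z"
    by (rule continuous_on_tendsto_compose[OF _ u]) auto
  moreover have "(\<lambda>j. ?r (u j)) \<longlonglongrightarrow> 0"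
    using res unfolding pg_residual_def by (rule tendsto_norm_zero_cancel)
  ultimately have "?r z = 0"
    by (rule LIMSEQ_unique)
  then show ?thesis
    unfolding stationary_def by simp
qed

section \<open>Accumulation points of the iterations that shrink eta\<close>

theorem theorem4p4:
  fixes f :: "real ^ 'n \<Rightarrow> real"
    and g h :: "nat \<Rightarrow> real ^ 'n \<Rightarrow> real"
    and X :: "(real ^ 'n) set"
    and x y :: "nat \<Rightarrow> real ^ 'n"
    and \<eta> \<mu> :: "nat \<Rightarrow> real"
    and \<gamma> \<delta> \<xi> \<theta> \<delta>' :: real
    and s m p \<rho> \<delta>_star :: nat
    and K\<^sub>u :: "nat set"
    and A_star :: "((real ^ 'n) \<times> (real ^ 'n)) set"
  assumes s_less: "s < CARD('n)"
    and g_convex: "\<And>i. i \<in> {1..m} \<Longrightarrow> convex_on UNIV (g i)"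
    and g_C1: "\<And>i. i \<in> {1..m} \<Longrightarrow> continuously_differentiable (g i)"
    and h_affine: "\<And>i. i \<in> {1..p} \<Longrightarrow> affine_function (h i)"
    and X_eq: "X = constraint_set m p g h"
    and f_C1: "continuously_differentiable f"
    and f_Lipschitz: "\<exists>L. L-lipschitz_on UNIV (gradient f)"
    and KKT: "\<And>ybar xbar. ybar \<in> Yset s \<Longrightarrow> xbar \<in> Xset X ybar \<Longrightarrow>
        stationary X f xbar ybar \<longleftrightarrow>
        (\<exists>lam mu gam. kkt_multipliers m p f g h {i. ybar $ i = 0} xbar lam mu gam)"
    and \<gamma>_range: "0 < \<gamma>" "\<gamma> < 1/2"
    and \<delta>_range: "0 < \<delta>" "\<delta> < 1"
    and \<xi>_pos: "0 < \<xi>"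
    and \<theta>_range: "0 < \<theta>" "\<theta> < 1"
    and \<delta>'_range: "0 < \<delta>'" "\<delta>' < 1"
    and \<eta>0_pos: "0 < \<eta> 0"
    and \<mu>0_pos: "0 < \<mu> 0"
    and y0: "y 0 \<in> Yset s"
    and x0: "x 0 \<in> Xset X (y 0)"
    and sequence: "SNS_sequence \<gamma> \<delta> \<xi> \<theta> \<delta>' (neighborhood \<rho> s X) X f x y \<eta> \<mu>"
    and level_compact: "compact {(u, v). v \<in> Yset s \<and> u \<in> Xset X v \<and> f u \<le> f (x 0) + \<xi>}"
    and Ku_eq: "K\<^sub>u = {k. k \<ge> 1 \<and> \<eta> k < \<eta> (k - 1)}"
    and A_star_eq: "A_star = accumulation_points K\<^sub>u x y"
    and \<delta>_star_eq: "\<delta>_star = Min {norm0 xs | xs ys. (xs, ys) \<in> A_star}"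
    and \<rho>_ge: "int \<rho> \<ge> 2 * (int s - int \<delta>_star)"
  shows "\<forall>(xs, ys) \<in> A_star. \<forall>J. super_support s xs J \<longrightarrow>
           (\<exists>lam mu gam. kkt_multipliers m p f g h J xs lam mu gam)"
proof (intro ballI, clarify)
  fix xs ys J
  assume A: "(xs, ys) \<in> A_star" and J: "super_support s xs J"
  have X: "closed X" "convex X"
    unfolding X_eq using g_C1 g_convex h_affine
    by (blast intro: closed_constraint_set convex_constraint_set
        continuously_differentiable_imp_continuous_on affine_function_imp_continuous_on)+
  have step: "SNS_step \<gamma> \<delta> \<xi> \<theta> \<delta>' (neighborhood \<rho> s X) X f
      (x k, y k, \<eta> k, \<mu> k) (x (Suc k), y (Suc k), \<eta> (Suc k), \<mu> (Suc k))" for k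
    using sequence unfolding SNS_sequence_def by blast
  have feas: "y k \<in> Yset s \<and> x k \<in> Xset X (y k)" for k
    by (induction k) (use y0 x0 SNS_step_feasible[OF step X \<delta>_range] in auto)
  have \<eta>_pos: "\<eta> k > 0" for k
  proof (induction k)
    case (Suc k)
    then show ?case
      using SNS_step_eta_cases[OF step, of k] \<theta>_range by auto
  qed (rule \<eta>0_pos)
  have "\<eta> (Suc k) \<le> \<eta> k" for k
    using SNS_step_eta_cases[OF step, of k] \<theta>_range \<eta>_pos[of k]
    by auto
  then have \<eta>_antimono: "\<eta> l \<le> \<eta> k" if "k \<le> l" for k l
    using lift_Suc_antimono_le that by blast

  obtain r where r: "strict_mono r" "range r \<subseteq> K\<^sub>u"
    and x_lim: "(\<lambda>j. x (r j)) \<longlonglongrightarrow> xs" and y_ev: "\<forall>\<^sub>F j in sequentially. y (r j) = ys"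
    using A unfolding A_star_eq accumulation_points_def by auto
  \<comment> \<open>Iteration \<open>q j\<close> is the one that shrinks \<eta> and produces
    \<open>x (r j)\<close>. Members of \<open>K\<^sub>u\<close> are at least 1, so the subtraction
    is not truncated.\<close>
  define q where "q j = r j - 1" for j
  have q: "Suc (q j) = r j" "\<eta> (Suc (q j)) < \<eta> (q j)" for j
  proof -
    have "r j \<in> K\<^sub>u"
      using r by auto
    then show "Suc (q j) = r j" "\<eta> (Suc (q j)) < \<eta> (q j)"
      unfolding q_def Ku_eq by auto
  qed
  \<comment> \<open>Each iteration \<open>q j\<close> multiplies \<eta> by \<theta>, and \<eta>
    never grows between \<open>Suc (q j)\<close> and \<open>q (Suc j)\<close>.\<close>
  have \<eta>_q: "\<eta> (q j) \<le> \<theta> ^ j * \<eta> 0" for j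
  proof (induction j)
    case 0
    then show ?case
      using \<eta>_antimono[of 0 "q 0"] by simp
  next
    case (Suc j)
    have "r j < r (Suc j)"
      using r(1) by (simp add: strict_mono_Suc_iff)
    then have "\<eta> (q (Suc j)) \<le> \<eta> (Suc (q j))"
      using q(1) by (intro \<eta>_antimono) (metis less_Suc_eq_le)
    also have "\<dots> = \<theta> * \<eta> (q j)"
      using SNS_step_eta_decreased(2)[OF step q(2)] .
    also have "\<dots> \<le> \<theta> * (\<theta> ^ j * \<eta> 0)"
      using Suc \<theta>_range by (intro mult_left_mono) auto
    finally show ?case
      by (simp add: mult.assoc)
  qed
  have \<eta>_lim: "(\<lambda>j. \<eta> (q j)) \<longlonglongrightarrow> 0"
  proof (rule tendsto_sandwich[OF _ _ tendsto_const])
    show "(\<lambda>j. \<theta> ^ j * \<eta> 0) \<longlonglongrightarrow> 0"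
      using \<theta>_range by (intro tendsto_mult_left_zero LIMSEQ_power_zero) auto
  qed (use \<eta>_q less_imp_le[OF \<eta>_pos] in auto)

  have ys: "ys \<in> Yset s" and xs: "xs \<in> Xset X ys"
  proof -
    show "ys \<in> Yset s"
      using eventually_happens[OF y_ev] feas by auto
    \<comment> \<open>Because \<open>y (r j)\<close> is eventually constant, the tail lies in one
      closed set.\<close>
    have "\<forall>\<^sub>F j in sequentially. x (r j) \<in> Xset X ys"
      using y_ev by eventually_elim (use feas in auto)
    then show "xs \<in> Xset X ys"
      by (rule Lim_in_closed_set[OF closed_Xset[OF X(1)] _ _ x_lim]) simp
  qed

  \<comment> \<open>The zeros of \<open>yh\<close> are exactly \<open>J\<close>, so the KKT property
    at \<open>yh\<close> yields multipliers vanishing on \<open>J\<close>.\<close>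
  define yh :: "real ^ 'n" where "yh = (\<chi> i. if i \<in> J then 0 else 1)"
  have C: "closed (Xset X yh)" "convex (Xset X yh)"
    using X by (auto intro: closed_Xset convex_Xset)
  have yh: "yh \<in> Yset s"
    using J unfolding yh_def super_support_def by (intro indicator_in_Yset) simp
  have xs_yh: "xs \<in> Xset X yh"
    using xs J unfolding Xset_def yh_def super_support_def by auto
  \<comment> \<open>Finiteness makes \<open>Min\<close> a genuine lower bound; \<open>norm0\<close>
    is at most the dimension.\<close>
  have "finite {norm0 xs | xs ys. (xs, ys) \<in> A_star}"
    by (rule finite_subset[of _ "{..CARD('n)}"]) (auto simp: norm0_def card_mono)
  then have "\<delta>_star \<le> norm0 xs"
    unfolding \<delta>_star_eq using A by (intro Min_le) auto
  then have "2 * (s - norm0 xs) \<le> \<rho>"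
    using \<rho>_ge by auto
  then have "hamming yh ys \<le> \<rho>"
    using hamming_indicator_le[OF ys xs J] unfolding yh_def by (rule order_trans[rotated])

  \<comment> \<open>The starting point of the candidate with binary part \<open>yh\<close>, once
    \<open>y (r j) = ys\<close>.\<close>
  define u where "u j = closest_point (Xset X yh) (zero_on (diff_set ys yh) (x (r j)))" for j
  have u_in: "u j \<in> Xset X yh" for j
    unfolding u_def using C xs_yh by (intro closest_point_in_set) auto
  have u_lim: "u \<longlonglongrightarrow> xs"
  proof -
    \<comment> \<open>Where \<open>ys\<close> and \<open>yh\<close> differ, one of them is nonzero
      and forces \<open>xs $ i = 0\<close>. Zeroing these components therefore does not move the
      limit.\<close>
    have "xs $ i * ys $ i = 0" "xs $ i * yh $ i = 0" for i
      using xs xs_yh unfolding Xset_def by auto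
    then have "xs $ i = 0" if "ys $ i \<noteq> yh $ i" for i
      using that by (metis mult_eq_0_iff)
    then have "zero_on (diff_set ys yh) xs = xs"
      unfolding zero_on_def vec_eq_iff diff_set_def by simp
    moreover have "(\<lambda>j. zero_on (diff_set ys yh) (x (r j))) \<longlonglongrightarrow> zero_on (diff_set ys yh) xs"
      unfolding zero_on_def
      by (intro vec_tendstoI) (use x_lim in \<open>auto intro: tendsto_vec_nth\<close>)
    ultimately have lim: "(\<lambda>j. zero_on (diff_set ys yh) (x (r j))) \<longlonglongrightarrow> xs"
      by simp
    have "continuous_on UNIV (closest_point (Xset X yh))"
      using continuous_on_closest_point C xs_yh by blast
    then have "u \<longlonglongrightarrow> closest_point (Xset X yh) xs"
      unfolding u_def by (rule continuous_on_tendsto_compose[OF _ lim]) auto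
    then show ?thesis
      using closest_point_self[OF xs_yh] by simp
  qed
  have f_lim: "(\<lambda>j. f (w j)) \<longlonglongrightarrow> f xs" if "w \<longlonglongrightarrow> xs" for w
    by (rule continuous_on_tendsto_compose[OF
          continuously_differentiable_imp_continuous_on[OF f_C1, of UNIV] that]) auto
  have gap_lim: "(\<lambda>j. f (u j) - f (x (r j))) \<longlonglongrightarrow> 0"
    using tendsto_diff[OF f_lim[OF u_lim] f_lim[OF x_lim]] by simp

  obtain c where "c > 0"
    and c: "\<And>X x y. closed (Xset X y) \<Longrightarrow> convex (Xset X y) \<Longrightarrow> x \<in> Xset X y \<Longrightarrow>
       c * (pg_residual X f x y)\<^sup>2 \<le> f x - f (PGLS \<gamma> \<delta> X f x y)"
    using PGLS_sufficient_decrease[OF f_C1 f_Lipschitz \<gamma>_range \<delta>_range] by blast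
  \<comment> \<open>Positivity of \<xi> makes the candidate eventually pass the filter defining the
    search set.\<close>
  have "\<forall>\<^sub>F j in sequentially. f (u j) - f (x (r j)) < \<xi>"
    using gap_lim \<xi>_pos by (rule order_tendstoD)
  with y_ev have bound: "\<forall>\<^sub>F j in sequentially.
      (pg_residual X f (u j) yh)\<^sup>2 \<le> (f (u j) - f (x (r j)) + \<eta> (q j)) / c"
  proof eventually_elim
    case (elim j)
    \<comment> \<open>Iteration \<open>q j\<close> keeps the binary part, so its neighborhood is
      centred at \<open>(x (r j), ys)\<close> and contains \<open>(u j, yh)\<close>.\<close>
    note dec = SNS_step_eta_decreased[OF step[of "q j"] q(2)]
    have "diff_set ys yh = diff_set (y (q j)) yh" "y (q j) = ys"
      using dec(1) elim q(1)[of j] by auto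
    then have "(u j, yh) \<in> neighborhood \<rho> s X (x (Suc (q j))) (y (q j))"
      using yh xs_yh \<open>hamming yh ys \<le> \<rho>\<close> q(1)[of j] unfolding neighborhood_def u_def by auto
    then have "f (x (r j)) - \<eta> (q j) < f (PGLS \<gamma> \<delta> X f (u j) yh)"
      using dec(3) elim q(1)[of j] by auto
    \<comment> \<open>Rejection caps the decrease from \<open>u j\<close> by the numerator, while
      the line search guarantees at least \<open>c\<close> times the squared residual.\<close>
    then show ?case
      using c[OF C u_in, of j] \<open>c > 0\<close> by (simp add: field_simps)
  qed
  have "(\<lambda>j. (f (u j) - f (x (r j)) + \<eta> (q j)) / c) \<longlonglongrightarrow> (0 + 0) / c"
    using \<open>c > 0\<close> by (intro tendsto_intros gap_lim \<eta>_lim) auto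
  then have "(\<lambda>j. (pg_residual X f (u j) yh)\<^sup>2) \<longlonglongrightarrow> 0"
    by (intro tendsto_sandwich[OF _ bound tendsto_const]) auto
  then have "(\<lambda>j. pg_residual X f (u j) yh) \<longlonglongrightarrow> 0"
    by (simp add: power_tendsto_0_iff)
  then have "stationary X f xs yh"
    using stationary_limit[OF f_C1 C _ u_lim] xs_yh by blast
  then obtain lam mu gam where "kkt_multipliers m p f g h {i. yh $ i = 0} xs lam mu gam"
    using KKT[OF yh xs_yh] by blast
  moreover have "{i. yh $ i = 0} = J"
    unfolding yh_def by auto
  ultimately show "\<exists>lam mu gam. kkt_multipliers m p f g h J xs lam mu gam"
    by auto
qed

end
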